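(* Let $(X,d,\mu)$ be a metric space with metrically continuous measure $\mu$ and such that balls are connected. Let $\Omega\subsetneq X$ be a domain with compact boundary and let $g:\partial\Omega\to\mathbb{R}$ be continuous. Suppose that for every ball $B$ with $\overline{B}\subset\Omega$ and every continuous boundary data on $\partial B$ there exists a solution of the Dirichlet problem in $B$. Then the lower Perron solution $P_\Omega[g]$ is a strongly harmonic function in $\Omega$. Moreover, if $\Omega$ has a barrier at $x_0\in\partial\Omega$, then $$\lim_{\Omega\ni y\to x_0}P_\Omega[g](y)=g(x_0).$$
   Context: Standing assumptions: $\mu$ is Borel regular, $0<\mu(B)<\infty$ for every ball $B$, and $X$ is proper. A domain is an open connected set; $A\Subset\Omega$ means that the closure of $A$ is a compact subset of $\Omega$. $\mu$ is metrically continuous if $\lim_{y\to x}\mu(B(x,r)\Delta B(y,r))=0$ for all $x\in X$, $r>0$. A locally integrable $f:\Omega\to\mathbb{R}$ is strongly harmonic in $\Omega$ if $f(x)=\frac{1}{\mu(B(x,r))}\int_{B(x,r)}f\,d\mu$ for all $x\in\Omega$, $r>0$ with $B(x,r)\Subset\Omega$. A solution of the Dirichlet problem in an open set $U$ with continuous boundary data $h:\partial U\to\mathbb{R}$ is a function in $C(\overline U)$, strongly harmonic in $U$ and equal to $h$ on $\partial U$. A continuous function $f$ on $\Omega$ is locally subharmonic in $\Omega$ if for every $x\in\Omega$ there is $R_x>0$ such that $\overline{B(x,R_x)}\subset\Omega$ and $f(x)\le\frac{1}{\mu(B(x,\rho))}\int_{B(x,\rho)}f\,d\mu$ for $0<\rho<R_x$.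 $S_g$ is the family of all locally subharmonic functions $f$ in $\Omega$ (continuous on $\overline\Omega$) with $f\le g$ on $\partial\Omega$, and $P_\Omega[g](x):=\sup_{f\in S_g}f(x)$, $x\in\Omega$. A barrier for $\Omega$ at $x_0\in\partial\Omega$ is a continuous function $f$ on $\overline\Omega$ that is locally subharmonic in $\Omega$, with $f(x_0)=0$ and $f(x)<0$ for every $x\in\partial\Omega\setminus\{x_0\}$.
   Formalization: For unbounded Ω, the lower Perron solution is additionally assumed to be finite on Ω; without this the claim fails, e.g. X=ℝ with Lebesgue measure, Ω=(0,∞), g=0, where cx lies in S_g for all c>0 and P is infinite. *)

theory Defs
  imports "HOL-Analysis.Analysis"
begin

text \<open>
  The metric space is the whole type, with its metric topology; balls are open balls of positive
  radius, and the overlined ball is the topological closure of the open ball.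
\<close>

text \<open>
  A Borel regular outer measure is represented by a measure on a sigma-algebra containing the
  Borel sets; the outer measure itself is \<open>outer_measure_of M\<close>. Both the restriction to the Borel
  sets and the restriction to the Caratheodory-measurable sets are covered.
\<close>

definition borel_regular :: "'a::topological_space measure \<Rightarrow> bool" where
  "borel_regular M \<longleftrightarrow> sets borel \<subseteq> sets M \<and>
     (\<forall>A. \<exists>B\<in>sets borel. A \<subseteq> B \<and> emeasure M B = outer_measure_of M A)"

definition metrically_continuous :: "'a::metric_space measure \<Rightarrow> bool" where
  "metrically_continuous M \<longleftrightarrow>
     (\<forall>x r. r > 0 \<longrightarrow>
        ((\<lambda>y. emeasure M ((ball x r - ball y r) \<union> (ball y r - ball x r))) \<longlongrightarrow> 0) (at x))"

definition compactly_contained :: "'a::topological_space set \<Rightarrow> 'a set \<Rightarrow> bool" where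
  "compactly_contained A \<Omega> \<longleftrightarrow> compact (closure A) \<and> closure A \<subseteq> \<Omega>"

definition is_domain :: "'a::topological_space set \<Rightarrow> bool" where
  "is_domain \<Omega> \<longleftrightarrow> open \<Omega> \<and> connected \<Omega>"

definition locally_integrable_on ::
    "'a::topological_space measure \<Rightarrow> 'a set \<Rightarrow> ('a \<Rightarrow> real) \<Rightarrow> bool" where
  "locally_integrable_on M \<Omega> f \<longleftrightarrow> (\<forall>K. compact K \<and> K \<subseteq> \<Omega> \<longrightarrow> set_integrable M K f)"

definition ball_mean :: "'a::metric_space measure \<Rightarrow> ('a \<Rightarrow> real) \<Rightarrow> 'a \<Rightarrow> real \<Rightarrow> real" where
  "ball_mean M f x r = 1 / measure M (ball x r) * (LINT y:ball x r|M. f y)"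

definition strongly_harmonic_on ::
    "'a::metric_space measure \<Rightarrow> 'a set \<Rightarrow> ('a \<Rightarrow> real) \<Rightarrow> bool" where
  "strongly_harmonic_on M \<Omega> f \<longleftrightarrow> locally_integrable_on M \<Omega> f \<and>
     (\<forall>x\<in>\<Omega>. \<forall>r>0. compactly_contained (ball x r) \<Omega> \<longrightarrow> f x = ball_mean M f x r)"

definition dirichlet_solution ::
    "'a::metric_space measure \<Rightarrow> 'a set \<Rightarrow> ('a \<Rightarrow> real) \<Rightarrow> ('a \<Rightarrow> real) \<Rightarrow> bool" where
  "dirichlet_solution M U h u \<longleftrightarrow>
     continuous_on (closure U) u \<and> strongly_harmonic_on M U u \<and> (\<forall>x\<in>frontier U. u x = h x)"

definition locally_subharmonic_on ::
    "'a::metric_space measure \<Rightarrow> 'a set \<Rightarrow> ('a \<Rightarrow> real) \<Rightarrow> bool" where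
  "locally_subharmonic_on M \<Omega> f \<longleftrightarrow> continuous_on \<Omega> f \<and>
     (\<forall>x\<in>\<Omega>. \<exists>R>0. closure (ball x R) \<subseteq> \<Omega> \<and>
        (\<forall>\<rho>. 0 < \<rho> \<and> \<rho> < R \<longrightarrow> f x \<le> ball_mean M f x \<rho>))"

definition perron_family ::
    "'a::metric_space measure \<Rightarrow> 'a set \<Rightarrow> ('a \<Rightarrow> real) \<Rightarrow> ('a \<Rightarrow> real) set" where
  "perron_family M \<Omega> g = {f. continuous_on (closure \<Omega>) f \<and> locally_subharmonic_on M \<Omega> f \<and>
     (\<forall>x\<in>frontier \<Omega>. f x \<le> g x)}"

text \<open>
  The supremum is taken in the extended reals: on an unbounded domain it can be infinite, as for
  the half-line \<open>{0<..}\<close> in the reals with Lebesgue measure, where \<open>\<lambda>x. c * x\<close> belongs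
  to the family for zero boundary data, for every \<open>c\<close>.
\<close>

definition lower_perron ::
    "'a::metric_space measure \<Rightarrow> 'a set \<Rightarrow> ('a \<Rightarrow> real) \<Rightarrow> 'a \<Rightarrow> ereal" where
  "lower_perron M \<Omega> g x = (SUP f\<in>perron_family M \<Omega> g. ereal (f x))"

definition is_barrier ::
    "'a::metric_space measure \<Rightarrow> 'a set \<Rightarrow> 'a \<Rightarrow> ('a \<Rightarrow> real) \<Rightarrow> bool" where
  "is_barrier M \<Omega> x0 f \<longleftrightarrow> continuous_on (closure \<Omega>) f \<and> locally_subharmonic_on M \<Omega> f \<and>
     f x0 = 0 \<and> (\<forall>x\<in>frontier \<Omega> - {x0}. f x < 0)"

end

theory Submission imports Defs begin

text \<open>
  This is Perron's method. Replacing a member of the Perron family on a ball by the solution of the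
  Dirichlet problem there gives a larger member that is harmonic on the ball. An increasing sequence
  of such members that approximates the Perron solution at the centre converges to a function with
  the mean value property (monotone convergence), which is continuous because the measure is
  metrically continuous; a second sequence, built above the first one to approximate the Perron
  solution at another point, has the same limit by the strong maximum principle, as balls are
  connected. At a boundary point, multiples of the barrier give a member of the family below and a
  majorant of the family above.
\<close>

text \<open>Strong harmonicity asks for the mean value identity at every radius for which the
  closure of the ball lies in \<open>\<Omega>\<close>, not only at small ones. The modification is
  therefore carried out on the very ball whose mean is wanted, which is where solvability of the
  Dirichlet problem in all such balls enters. No Harnack inequality or compactness of families of
  harmonic functions is used. Taking the maximum with the preceding member makes each sequence
  increasing, and the mean value identity itself controls the integrals. The strong maximum
  principle is then applied to the difference of two limits, so continuity has to be recovered from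
  the identity alone. The upper bound for the family comes from a maximum principle on
  \<open>\<Omega>\<close>. On unbounded sets this principle can fail, and the assumption
  \<open>bounded_or_finite\<close> restores it.\<close>

section \<open>Absolute continuity of the integral\<close>

text \<open>Truncation at height \<open>n\<close> leaves a remainder of small integral, by dominated
  convergence, while the bounded part contributes at most \<open>n\<close> times the measure of the
  set. A general filter is allowed because the sets will be symmetric differences of balls with
  moving centre.\<close>

lemma tendsto_integral_small_sets:
  fixes f :: "'a \<Rightarrow> real"
  assumes f: "integrable M f" and A: "\<And>y. A y \<in> sets M"
    and lim: "((\<lambda>y. emeasure M (A y)) \<longlongrightarrow> 0) F"
  shows "((\<lambda>y. LINT x:A y|M. \<bar>f x\<bar>) \<longlongrightarrow> 0) F"
proof (rule tendstoI)
  fix e :: real assume e: "e > 0"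
  have "(\<lambda>n. LINT x|M. min \<bar>f x\<bar> (real n)) \<longlonglongrightarrow> (LINT x|M. \<bar>f x\<bar>)"
  proof (rule integral_dominated_convergence[where w = "\<lambda>x. \<bar>f x\<bar>"])
    show "AE x in M. (\<lambda>n. min \<bar>f x\<bar> (real n)) \<longlonglongrightarrow> \<bar>f x\<bar>"
    proof (rule AE_I2)
      fix x
      have "\<forall>\<^sub>F n in sequentially. min \<bar>f x\<bar> (real n) = \<bar>f x\<bar>"
        by (rule eventually_sequentiallyI[of "nat \<lceil>\<bar>f x\<bar>\<rceil>"]) linarith
      then show "(\<lambda>n. min \<bar>f x\<bar> (real n)) \<longlonglongrightarrow> \<bar>f x\<bar>"
        by (rule tendsto_eventually)
    qed
  qed (use f in auto)
  then have "\<forall>\<^sub>F n in sequentially. dist (LINT x|M. min \<bar>f x\<bar> (real n)) (LINT x|M. \<bar>f x\<bar>) < e / 2"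
    using e by (intro tendstoD) auto
  then obtain n where n: "dist (LINT x|M. min \<bar>f x\<bar> (real n)) (LINT x|M. \<bar>f x\<bar>) < e / 2"
    by (auto simp: eventually_sequentially)
  define m where "m = (\<lambda>x. min \<bar>f x\<bar> (real n))"
  have m: "integrable M m"
    unfolding m_def using f by (intro Bochner_Integration.integrable_bound[OF f]) auto
  \<comment> \<open>The summand 1 keeps the denominator positive when \<open>n = 0\<close>.\<close>
  define d where "d = e / (2 * (real n + 1))"
  have d: "d > 0" using e by (simp add: d_def)
  then have "\<forall>\<^sub>F y in F. emeasure M (A y) < ennreal d"
    using lim by (intro order_tendstoD) auto
  then show "\<forall>\<^sub>F y in F. dist (LINT x:A y|M. \<bar>f x\<bar>) 0 < e"
  proof eventually_elim
    case (elim y)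
    have fin: "emeasure M (A y) < \<infinity>"
      using elim by (metis ennreal_less_top infinity_ennreal_def less_trans)
    have meas: "measure M (A y) < d"
      using elim d fin by (metis emeasure_eq_ennreal_measure ennreal_less_iff infinity_ennreal_def
          less_irrefl measure_nonneg)
    \<comment> \<open>On \<open>A y\<close> the truncation \<open>m\<close> is at most
      \<open>n\<close>; off \<open>A y\<close> the remainder \<open>\<bar>f x\<bar> - m x\<close> is
      nonnegative.\<close>
    have "(LINT x:A y|M. \<bar>f x\<bar>) \<le> (LINT x|M. (\<bar>f x\<bar> - m x) + real n * indicator (A y) x)"
      unfolding set_lebesgue_integral_def
    proof (rule integral_mono)
      show "integrable M (\<lambda>x. indicat_real (A y) x *\<^sub>R \<bar>f x\<bar>)"
        using f A by (intro integrable_mult_indicator) auto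
      show "integrable M (\<lambda>x. \<bar>f x\<bar> - m x + real n * indicat_real (A y) x)"
        using f m A fin by (intro Bochner_Integration.integrable_add Bochner_Integration.integrable_diff)
            (auto intro!: integrable_real_indicator)
    qed (auto simp: m_def split: split_indicator)
    also have "\<dots> = (LINT x|M. \<bar>f x\<bar>) - (LINT x|M. m x) + real n * measure M (A y)"
      using f m A fin by (subst Bochner_Integration.integral_add)
         (auto intro!: integrable_real_indicator Bochner_Integration.integrable_diff)
    also have "\<dots> < e / 2 + e / 2"
    proof (rule add_less_le_mono)
      show "(LINT x|M. \<bar>f x\<bar>) - (LINT x|M. m x) < e / 2"
        using n unfolding m_def dist_real_def by linarith
      have "real n * measure M (A y) \<le> (real n + 1) * d"
        using meas d by (intro mult_mono) auto
      also have "\<dots> = e / 2" by (simp add: d_def field_simps)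
      finally show "real n * measure M (A y) \<le> e / 2" .
    qed
    finally have "(LINT x:A y|M. \<bar>f x\<bar>) < e" by simp
    moreover have "0 \<le> (LINT x:A y|M. \<bar>f x\<bar>)"
      unfolding set_lebesgue_integral_def by (intro integral_nonneg_AE) auto
    ultimately show ?case by (simp add: dist_real_def)
  qed
qed

text \<open>The mean value property is demanded for closed balls inside the set: these are compactly
  contained, and they exhaust the open balls.\<close>

definition mean_value_on :: "'a::metric_space measure \<Rightarrow> 'a set \<Rightarrow> ('a \<Rightarrow> real) \<Rightarrow> bool" where
  "mean_value_on M B v \<longleftrightarrow>
     (\<forall>x s. 0 < s \<and> cball x s \<subseteq> B \<longrightarrow> set_integrable M (ball x s) v \<and> v x = ball_mean M v x s)"

lemma ball_mean_cong:
  "(\<And>y. y \<in> ball x r \<Longrightarrow> f y = h y) \<Longrightarrow> ball_mean M f x r = ball_mean M h x r"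
  unfolding ball_mean_def set_lebesgue_integral_def
  by (metis (no_types, lifting) indicator_simps(2) scale_zero_left)

lemma mean_value_on_cong:
  assumes "mean_value_on M B v" and eq: "\<And>x. x \<in> B \<Longrightarrow> v x = w x"
  shows "mean_value_on M B w"
  unfolding mean_value_on_def
proof (intro allI impI)
  fix x s assume *: "0 < s \<and> cball x s \<subseteq> B"
  then have sub: "y \<in> B" if "y \<in> ball x s" for y
    using that ball_subset_cball by blast
  have "x \<in> B" using * by auto
  have "ball_mean M v x s = ball_mean M w x s"
    using sub eq by (intro ball_mean_cong) auto
  moreover have "set_integrable M (ball x s) v \<longleftrightarrow> set_integrable M (ball x s) w"
    using sub eq by (intro set_integrable_cong) auto
  ultimately show "set_integrable M (ball x s) w \<and> w x = ball_mean M w x s"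
    using assms(1) * eq[OF \<open>x \<in> B\<close>] unfolding mean_value_on_def by metis
qed

lemma mean_value_on_diff:
  "mean_value_on M B v \<Longrightarrow> mean_value_on M B w \<Longrightarrow> mean_value_on M B (\<lambda>x. v x - w x)"
  unfolding mean_value_on_def ball_mean_def
  by (auto simp: set_integral_diff right_diff_distrib)

text \<open>Only an inclusion: in a general metric space the closure of an open ball can be smaller
  than the closed ball, so the two kinds of hypotheses on balls are kept apart.\<close>

lemma closure_ball_subset_cball: "closure (ball x r) \<subseteq> cball x r"
  by (rule closure_minimal) auto

lemma locally_subharmonic_on_subset:
  assumes f: "locally_subharmonic_on M \<Omega> f" and U: "open U" "U \<subseteq> \<Omega>"
  shows "locally_subharmonic_on M U f"
  unfolding locally_subharmonic_on_def
proof (intro conjI ballI)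
  show "continuous_on U f"
    using f U continuous_on_subset unfolding locally_subharmonic_on_def by blast
  fix x assume x: "x \<in> U"
  obtain e where e: "e > 0" "cball x e \<subseteq> U"
    using U x open_contains_cball by blast
  from f x U obtain R where R: "R > 0" "\<And>\<rho>. 0 < \<rho> \<Longrightarrow> \<rho> < R \<Longrightarrow> f x \<le> ball_mean M f x \<rho>"
    unfolding locally_subharmonic_on_def by blast
  have "closure (ball x (min e R)) \<subseteq> U"
    using closure_ball_subset_cball[of x "min e R"] e by (force simp: subset_iff)
  then show "\<exists>R>0. closure (ball x R) \<subseteq> U \<and> (\<forall>\<rho>. 0 < \<rho> \<and> \<rho> < R \<longrightarrow> f x \<le> ball_mean M f x \<rho>)"
    using R e by (intro exI[of _ "min e R"]) auto
qed

section \<open>Ball means, harmonic and subharmonic functions in a proper space\<close>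

locale proper_measure_space =
  fixes M :: "'a::metric_space measure"
  assumes borel_sets: "sets borel \<subseteq> sets M"
    and emeasure_ball: "0 < r \<Longrightarrow> 0 < emeasure M (ball x r) \<and> emeasure M (ball x r) < \<infinity>"
    and proper: "compact (cball (x::'a) r)"
begin

lemma space_eq_UNIV [simp]: "space M = UNIV"
  proof -
  have "UNIV \<in> sets (borel :: 'a measure)" by simp
  then show ?thesis using borel_sets sets.sets_into_space[of UNIV M] by blast
qed

lemma open_in_sets [simp]: "open A \<Longrightarrow> A \<in> sets M"
  using borel_sets by auto

lemma borel_measurable_M: "f \<in> borel_measurable borel \<Longrightarrow> f \<in> borel_measurable M"
  using borel_sets by (auto simp: measurable_def)

lemma measure_ball_pos: "0 < r \<Longrightarrow> 0 < measure M (ball x r)"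
  using emeasure_ball[of r x] by (auto simp: measure_def enn2real_positive_iff)

lemma emeasure_compact_finite:
  assumes "compact K" shows "emeasure M K < \<infinity>"
proof -
  obtain x r where "K \<subseteq> cball x r"
    using compact_imp_bounded[OF assms] unfolding bounded_subset_cball by blast
  then have "K \<subseteq> ball x (\<bar>r\<bar> + 1)" by (auto simp: subset_iff)
  then have "emeasure M K \<le> emeasure M (ball x (\<bar>r\<bar> + 1))"
    by (intro emeasure_mono) auto
  also have "\<dots> < \<infinity>" using emeasure_ball[of "\<bar>r\<bar> + 1" x] by auto
  finally show ?thesis .
qed

lemma compact_closure_bounded:
  assumes "bounded (S :: 'a set)" shows "compact (closure S)"
proof -
  obtain x r where "S \<subseteq> cball x r"
    using assms unfolding bounded_subset_cball by blast
  then have "closure S \<subseteq> cball x r" by (simp add: closure_minimal)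
  then have "closure S = cball x r \<inter> closure S" by blast
  then show ?thesis using compact_Int_closed[OF proper closed_closure] by metis
qed

lemma set_integrable_compact:
  fixes f :: "'a \<Rightarrow> real"
  assumes K: "compact K" and f: "continuous_on K f"
  shows "set_integrable M K f"
proof -
  have Kb: "K \<in> sets borel" using K by (simp add: borel_compact)
  obtain c where c: "\<And>x. x \<in> K \<Longrightarrow> norm (f x) \<le> c"
    using compact_imp_bounded[OF compact_continuous_image[OF f K]] unfolding bounded_iff by auto
  show ?thesis unfolding set_integrable_def
  proof (rule integrableI_bounded_set[where A = K and B = c])
    show "K \<in> sets M" using Kb borel_sets by auto
    show "(\<lambda>x. indicat_real K x *\<^sub>R f x) \<in> borel_measurable M"
      using borel_measurable_continuous_on_indicator[OF Kb f] by (rule borel_measurable_M)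
  qed (use emeasure_compact_finite[OF K] c in auto)
qed

lemma set_integrable_ball:
  fixes f :: "'a \<Rightarrow> real"
  assumes "continuous_on \<Omega> f" "closure (ball x R) \<subseteq> \<Omega>" "\<rho> \<le> R"
  shows "set_integrable M (ball x \<rho>) f"
proof -
  have "set_integrable M (closure (ball x R)) f"
    using assms by (intro set_integrable_compact compact_closure_bounded)
      (auto intro: continuous_on_subset)
  then show ?thesis
    using assms closure_subset[of "ball x R"] by (rule_tac set_integrable_subset) auto
qed

lemma set_integrable_ball_const: "set_integrable M (ball x r) (\<lambda>_. c::real)"
  by (rule set_integrable_ball[of UNIV]) auto

lemma ball_integral_const: "(LINT y:ball x r|M. c) = c * measure M (ball x r)"
  for c :: real
proof -
  have "emeasure M (ball x r) \<noteq> \<infinity>"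
    using emeasure_ball[of r x] by (cases "r > 0") (auto simp: ball_empty)
  then show ?thesis by (simp add: set_integral_const)
qed

lemma ball_mean_const: "0 < r \<Longrightarrow> ball_mean M (\<lambda>_. c) x r = c"
  using measure_ball_pos[of r x] by (simp add: ball_mean_def ball_integral_const)

lemma le_ball_mean_iff:
  "0 < r \<Longrightarrow> c \<le> ball_mean M f x r \<longleftrightarrow> c * measure M (ball x r) \<le> (LINT y:ball x r|M. f y)"
  using measure_ball_pos[of r x] by (simp add: ball_mean_def field_simps)

lemma ball_mean_mono:
  assumes "0 < r" "set_integrable M (ball x r) f" "set_integrable M (ball x r) h"
    and "\<And>y. y \<in> ball x r \<Longrightarrow> f y \<le> h y"
  shows "ball_mean M f x r \<le> ball_mean M h x r"
  unfolding ball_mean_def using assms by (intro mult_left_mono set_integral_mono) auto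

text \<open>A value below \<open>m\<close> at one point persists on a small ball by continuity. That
  ball has positive measure, which would push the mean strictly below \<open>m\<close>. This is the
  local step of both maximum principles.\<close>

lemma ball_mean_attains_max:
  assumes r: "0 < r" and cont: "continuous_on (ball x r) f" and int: "set_integrable M (ball x r) f"
    and le: "\<And>y. y \<in> ball x r \<Longrightarrow> f y \<le> m" and mean: "m \<le> ball_mean M f x r"
    and y: "y \<in> ball x r"
  shows "f y = m"
proof (rule ccontr)
  assume "f y \<noteq> m"
  \<comment> \<open>Half of the gap, so that \<open>f y < m - e\<close> is strict and survives near
    \<open>y\<close>.\<close>
  define e where "e = (m - f y) / 2"
  have e: "e > 0" "f y < m - e"
    using le[OF y] \<open>f y \<noteq> m\<close> by (auto simp: e_def field_simps)
  have "isCont f y"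
    using cont y continuous_on_eq_continuous_at open_ball by blast
  then have "\<forall>\<^sub>F z in nhds y. f z < m - e"
    using e unfolding isCont_def tendsto_at_iff_tendsto_nhds by (intro order_tendstoD(2)) auto
  moreover have "\<forall>\<^sub>F z in nhds y. z \<in> ball x r"
    using y by (intro eventually_nhds_in_open) auto
  ultimately have "\<forall>\<^sub>F z in nhds y. f z < m - e \<and> z \<in> ball x r"
    by (rule eventually_conj)
  then obtain d where d: "d > 0" "\<And>z. z \<in> ball y d \<Longrightarrow> f z < m - e \<and> z \<in> ball x r"
    unfolding eventually_nhds_metric by (auto simp: dist_commute)
  have fin: "emeasure M (ball x r) < \<infinity>" "emeasure M (ball y d) < \<infinity>"
    using emeasure_ball r d by auto
  have "m * measure M (ball x r) \<le> (LINT z:ball x r|M. f z)"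
    using mean le_ball_mean_iff[OF r] by blast
  \<comment> \<open>The comparison function is \<open>m\<close> on the large ball, lowered by
    \<open>e\<close> on the small ball inside it.\<close>
  also have "\<dots> \<le> (LINT z|M. m * indicator (ball x r) z - e * indicator (ball y d) z)"
    unfolding set_lebesgue_integral_def
  proof (rule integral_mono)
    show "integrable M (\<lambda>z. indicat_real (ball x r) z *\<^sub>R f z)"
      using int by (simp add: set_integrable_def)
    show "integrable M (\<lambda>z. m * indicat_real (ball x r) z - e * indicat_real (ball y d) z)"
      using fin by (intro Bochner_Integration.integrable_diff integrable_mult_right
          integrable_real_indicator) auto
    fix z
    show "indicat_real (ball x r) z *\<^sub>R f z
        \<le> m * indicat_real (ball x r) z - e * indicat_real (ball y d) z"
    proof (cases "z \<in> ball y d")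
      case True
      then show ?thesis using d(2)[OF True] by simp
    next
      case False
      then show ?thesis using le[of z] by (auto split: split_indicator)
    qed
  qed
  also have "\<dots> = m * measure M (ball x r) - e * measure M (ball y d)"
    using fin by (subst Bochner_Integration.integral_diff)
       (auto intro!: integrable_real_indicator)
  finally have "e * measure M (ball y d) \<le> 0" by simp
  then show False using e(1) measure_ball_pos[OF d(1), of y] by (simp add: mult_le_0_iff)
qed

text \<open>Two integrals over balls of equal radius differ by at most the integral of
  \<open>\<bar>f\<bar>\<close> over the symmetric difference, whose measure tends to 0 by metric
  continuity. The margin \<open>R - s\<close> keeps the moving ball where \<open>f\<close> is
  integrable.\<close>

lemma ball_integral_tendsto:
  fixes f :: "'a \<Rightarrow> real"
  assumes mc: "metrically_continuous M" and s: "0 < s" "s < R"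
    and int: "set_integrable M (ball x R) f"
  shows "((\<lambda>y. LINT z:ball y s|M. f z) \<longlongrightarrow> (LINT z:ball x s|M. f z)) (at x)"
proof -
  \<comment> \<open>The cutoff makes the function integrable on the whole space, and changes nothing
    on the balls compared below.\<close>
  define h where "h = (\<lambda>z. indicator (ball x R) z *\<^sub>R f z)"
  have h: "integrable M h" using int by (simp add: h_def set_integrable_def)
  define A where "A = (\<lambda>y. (ball x s - ball y s) \<union> (ball y s - ball x s))"
  have A: "A y \<in> sets M" for y unfolding A_def by (intro sets.Un sets.Diff) auto
  have "((\<lambda>y. LINT z:A y|M. \<bar>h z\<bar>) \<longlongrightarrow> 0) (at x)"
    using mc s by (intro tendsto_integral_small_sets[OF h A])
       (auto simp: metrically_continuous_def A_def)
  moreover have "\<forall>\<^sub>F y in at x. norm ((LINT z:ball y s|M. f z) - (LINT z:ball x s|M. f z))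
      \<le> (LINT z:A y|M. \<bar>h z\<bar>)"
    unfolding eventually_at
  proof (intro exI[of _ "R - s"] conjI ballI impI)
    fix y assume "y \<noteq> x \<and> dist y x < R - s"
    then have y: "dist x y < R - s" by (simp add: dist_commute)
    have "z \<in> ball x R" if "z \<in> ball y s" for z
      using dist_triangle[of x z y] y that by simp
    then have sub: "ball y s \<subseteq> ball x R" "ball x s \<subseteq> ball x R"
      using s by auto
    have i: "set_integrable M (ball y s) f" "set_integrable M (ball x s) f"
      using sub int by (auto intro: set_integrable_subset)
    have "(LINT z:ball y s|M. f z) - (LINT z:ball x s|M. f z)
        = (LINT z|M. indicator (ball y s) z *\<^sub>R f z - indicator (ball x s) z *\<^sub>R f z)"
      using i unfolding set_integrable_def set_lebesgue_integral_def by simp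
    also have "norm \<dots> \<le> (LINT z|M. norm (indicator (ball y s) z *\<^sub>R f z - indicator (ball x s) z *\<^sub>R f z))"
      by (rule integral_norm_bound)
    \<comment> \<open>Exactly one of the two indicators is 1 on \<open>A y\<close>, and they agree
      off it.\<close>
    also have "\<dots> = (LINT z:A y|M. \<bar>h z\<bar>)"
      unfolding set_lebesgue_integral_def
      using sub by (intro Bochner_Integration.integral_cong)
         (auto simp: h_def A_def subset_iff split: split_indicator)
    finally show "norm ((LINT z:ball y s|M. f z) - (LINT z:ball x s|M. f z)) \<le> (LINT z:A y|M. \<bar>h z\<bar>)" .
  qed (use s in auto)
  ultimately have "((\<lambda>y. (LINT z:ball y s|M. f z) - (LINT z:ball x s|M. f z)) \<longlongrightarrow> 0) (at x)"
    by (rule Lim_null_comparison[rotated])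
  then show ?thesis by (simp add: LIM_zero_iff)
qed

text \<open>With one radius for all centres near \<open>x\<close>, the function is a quotient of two
  ball integrals, each depending continuously on the centre.\<close>

lemma mean_value_continuous_on:
  assumes mc: "metrically_continuous M" and B: "open B" and v: "mean_value_on M B v"
  shows "continuous_on B v"
proof (rule continuous_at_imp_continuous_on, rule ballI)
  fix x assume "x \<in> B"
  then obtain R where R: "R > 0" "cball x R \<subseteq> B"
    using B open_contains_cball by blast
  \<comment> \<open>For centres within \<open>R / 2\<close> of \<open>x\<close>, closed balls of
    radius \<open>R / 2\<close> stay in \<open>cball x R\<close>.\<close>
  define s where "s = R / 2"
  have s: "0 < s" "s < R" using R by (auto simp: s_def)
  have int: "set_integrable M (ball x R) v" using v R unfolding mean_value_on_def by auto
  have mean: "v y = ball_mean M v y s" if "dist y x \<le> s" for y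
  proof -
    have "cball y s \<subseteq> cball x R"
    proof
      fix z assume "z \<in> cball y s"
      then show "z \<in> cball x R"
        using that dist_triangle[of x z y] by (simp add: s_def dist_commute)
    qed
    then show ?thesis using v s R unfolding mean_value_on_def by blast
  qed
  have "((\<lambda>y. measure M (ball y s)) \<longlongrightarrow> measure M (ball x s)) (at x)"
    using ball_integral_tendsto[OF mc s set_integrable_ball_const[of x R 1]]
    by (simp add: ball_integral_const)
  then have "((\<lambda>y. ball_mean M v y s) \<longlongrightarrow> ball_mean M v x s) (at x)"
    unfolding ball_mean_def using measure_ball_pos[OF s(1), of x]
    by (intro tendsto_intros ball_integral_tendsto[OF mc s int]) auto
  then have "((\<lambda>y. ball_mean M v y s) \<longlongrightarrow> v x) (at x)"
    using mean[of x] s by simp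
  moreover have "\<forall>\<^sub>F y in at x. v y = ball_mean M v y s"
    unfolding eventually_at using s mean by (intro exI[of _ s]) auto
  ultimately show "isCont v x"
    unfolding isCont_def using tendsto_cong by fast
qed

lemma mean_value_locally_subharmonic_on:
  assumes B: "open B" and cont: "continuous_on B v" and v: "mean_value_on M B v"
  shows "locally_subharmonic_on M B v"
  unfolding locally_subharmonic_on_def
proof (intro conjI ballI cont)
  fix x assume "x \<in> B"
  then obtain R where R: "R > 0" "cball x R \<subseteq> B"
    using B open_contains_cball by blast
  have "v x \<le> ball_mean M v x \<rho>" if "0 < \<rho>" "\<rho> < R" for \<rho>
  proof -
    have "cball x \<rho> \<subseteq> B" using that R by (auto simp: subset_iff)
    then show ?thesis using v that unfolding mean_value_on_def by auto
  qed
  then show "\<exists>R>0. closure (ball x R) \<subseteq> B \<and> (\<forall>\<rho>. 0 < \<rho> \<and> \<rho> < R \<longrightarrow> v x \<le> ball_mean M v x \<rho>)"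
    using R closure_ball_subset_cball[of x R] by blast
qed

lemma mean_value_on_uminus:
  assumes "mean_value_on M B v"
  shows "mean_value_on M B (\<lambda>x. - v x)"
  using mean_value_on_diff[of M B "\<lambda>_. 0" v] assms
  by (auto simp: mean_value_on_def ball_mean_const set_integrable_ball_const)

lemma strongly_harmonic_on_imp_mean_value_on:
  assumes u: "strongly_harmonic_on M B u"
  shows "mean_value_on M B u"
  unfolding mean_value_on_def
proof (intro allI impI)
  fix x s assume xs: "0 < s \<and> cball x s \<subseteq> B"
  then have cl: "closure (ball x s) \<subseteq> B" using closure_ball_subset_cball by blast
  have "compact (closure (ball x s))" by (rule compact_closure_bounded) auto
  then have "set_integrable M (closure (ball x s)) u" "u x = ball_mean M u x s"
    using u xs cl unfolding strongly_harmonic_on_def locally_integrable_on_def compactly_contained_def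
    by (auto simp: subset_iff)
  then show "set_integrable M (ball x s) u \<and> u x = ball_mean M u x s"
    using closure_subset[of "ball x s"] by (auto intro: set_integrable_subset)
qed

lemma locally_subharmonic_on_const:
  assumes "open \<Omega>" shows "locally_subharmonic_on M \<Omega> (\<lambda>_. c)"
  using assms by (intro mean_value_locally_subharmonic_on)
    (auto simp: mean_value_on_def set_integrable_ball_const ball_mean_const)

lemma locally_subharmonic_on_cmult:
  assumes f: "locally_subharmonic_on M \<Omega> f" and c: "0 \<le> c"
  shows "locally_subharmonic_on M \<Omega> (\<lambda>x. c * f x)"
proof -
  have "ball_mean M (\<lambda>y. c * f y) x r = c * ball_mean M f x r" for x r
    by (simp add: ball_mean_def)
  then show ?thesis
    using f c unfolding locally_subharmonic_on_def
    by (auto intro!: continuous_on_mult_left) (meson mult_left_mono)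
qed

lemma locally_subharmonic_onD:
  assumes "locally_subharmonic_on M \<Omega> f" "x \<in> \<Omega>"
  shows "\<exists>R>0. closure (ball x R) \<subseteq> \<Omega> \<and>
    (\<forall>\<rho>. 0 < \<rho> \<longrightarrow> \<rho> < R \<longrightarrow> f x \<le> ball_mean M f x \<rho> \<and> set_integrable M (ball x \<rho>) f)"
proof -
  obtain R where R: "R > 0" "closure (ball x R) \<subseteq> \<Omega>"
    "\<And>\<rho>. 0 < \<rho> \<Longrightarrow> \<rho> < R \<Longrightarrow> f x \<le> ball_mean M f x \<rho>"
    using assms unfolding locally_subharmonic_on_def by blast
  moreover have "set_integrable M (ball x \<rho>) f" if "\<rho> < R" for \<rho>
    using assms(1) set_integrable_ball[of \<Omega> f x R \<rho>] R(2) that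
    unfolding locally_subharmonic_on_def by auto
  ultimately show ?thesis by blast
qed

text \<open>Integrability on the small balls follows from continuity, since their closures are
  compact subsets of \<open>\<Omega>\<close>. Offering it as a premise of the mean inequality spares
  each application that argument.\<close>

lemma locally_subharmonic_onI:
  assumes "continuous_on \<Omega> h"
    and "\<And>x. x \<in> \<Omega> \<Longrightarrow> \<exists>R>0. closure (ball x R) \<subseteq> \<Omega> \<and> (\<forall>\<rho>. 0 < \<rho> \<and> \<rho> < R \<longrightarrow>
           set_integrable M (ball x \<rho>) h \<longrightarrow> h x \<le> ball_mean M h x \<rho>)"
  shows "locally_subharmonic_on M \<Omega> h"
  unfolding locally_subharmonic_on_def
proof (intro conjI ballI assms(1))
  fix x assume "x \<in> \<Omega>"
  from assms(2)[OF this] obtain R where R: "R > 0" "closure (ball x R) \<subseteq> \<Omega>"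
    "\<And>\<rho>. 0 < \<rho> \<and> \<rho> < R \<Longrightarrow> set_integrable M (ball x \<rho>) h \<Longrightarrow> h x \<le> ball_mean M h x \<rho>"
    by blast
  moreover have "set_integrable M (ball x \<rho>) h" if "0 < \<rho> \<and> \<rho> < R" for \<rho>
    using set_integrable_ball[OF assms(1) R(2)] that by auto
  ultimately show "\<exists>R>0. closure (ball x R) \<subseteq> \<Omega> \<and> (\<forall>\<rho>. 0 < \<rho> \<and> \<rho> < R \<longrightarrow> h x \<le> ball_mean M h x \<rho>)"
    by blast
qed

lemma closure_ball_min:
  "closure (ball x R) \<subseteq> \<Omega> \<Longrightarrow> closure (ball x (min R S)) \<subseteq> \<Omega>"
  using closure_mono[of "ball x (min R S)" "ball x R"] by (auto simp: subset_iff)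

lemma locally_subharmonic_on_add:
  assumes f: "locally_subharmonic_on M \<Omega> f" and h: "locally_subharmonic_on M \<Omega> h"
  shows "locally_subharmonic_on M \<Omega> (\<lambda>x. f x + h x)"
proof (rule locally_subharmonic_onI)
  show "continuous_on \<Omega> (\<lambda>x. f x + h x)"
    using f h unfolding locally_subharmonic_on_def by (auto intro!: continuous_on_add continuous_on_max)
  fix x assume x: "x \<in> \<Omega>"
  obtain R where R: "R > 0" "closure (ball x R) \<subseteq> \<Omega>"
    "\<And>\<rho>. 0 < \<rho> \<Longrightarrow> \<rho> < R \<Longrightarrow> f x \<le> ball_mean M f x \<rho> \<and> set_integrable M (ball x \<rho>) f"
    using locally_subharmonic_onD[OF f x] by blast
  obtain S where S: "S > 0" "closure (ball x S) \<subseteq> \<Omega>"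
    "\<And>\<rho>. 0 < \<rho> \<Longrightarrow> \<rho> < S \<Longrightarrow> h x \<le> ball_mean M h x \<rho> \<and> set_integrable M (ball x \<rho>) h"
    using locally_subharmonic_onD[OF h x] by blast
  have "f x + h x \<le> ball_mean M (\<lambda>x. f x + h x) x \<rho>" if "0 < \<rho>" "\<rho> < R" "\<rho> < S" for \<rho>
  proof -
    have "ball_mean M (\<lambda>x. f x + h x) x \<rho> = ball_mean M f x \<rho> + ball_mean M h x \<rho>"
      using R(3)[of \<rho>] S(3)[of \<rho>] that
      by (simp add: ball_mean_def set_integral_add add_divide_distrib)
    then show ?thesis using R(3)[of \<rho>] S(3)[of \<rho>] that by auto
  qed
  then show "\<exists>R>0. closure (ball x R) \<subseteq> \<Omega> \<and> (\<forall>\<rho>. 0 < \<rho> \<and> \<rho> < R \<longrightarrow>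
           set_integrable M (ball x \<rho>) (\<lambda>x. f x + h x) \<longrightarrow> f x + h x \<le> ball_mean M (\<lambda>x. f x + h x) x \<rho>)"
    using R S closure_ball_min[OF R(2)] by (intro exI[of _ "min R S"]) auto
qed

lemma locally_subharmonic_on_max:
  assumes f: "locally_subharmonic_on M \<Omega> f" and h: "locally_subharmonic_on M \<Omega> h"
  shows "locally_subharmonic_on M \<Omega> (\<lambda>x. max (f x) (h x))"
proof (rule locally_subharmonic_onI)
  show "continuous_on \<Omega> (\<lambda>x. max (f x) (h x))"
    using f h unfolding locally_subharmonic_on_def by (auto intro!: continuous_on_add continuous_on_max)
  fix x assume x: "x \<in> \<Omega>"
  obtain R where R: "R > 0" "closure (ball x R) \<subseteq> \<Omega>"
    "\<And>\<rho>. 0 < \<rho> \<Longrightarrow> \<rho> < R \<Longrightarrow> f x \<le> ball_mean M f x \<rho> \<and> set_integrable M (ball x \<rho>) f"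
    using locally_subharmonic_onD[OF f x] by blast
  obtain S where S: "S > 0" "closure (ball x S) \<subseteq> \<Omega>"
    "\<And>\<rho>. 0 < \<rho> \<Longrightarrow> \<rho> < S \<Longrightarrow> h x \<le> ball_mean M h x \<rho> \<and> set_integrable M (ball x \<rho>) h"
    using locally_subharmonic_onD[OF h x] by blast
  have "max (f x) (h x) \<le> ball_mean M (\<lambda>x. max (f x) (h x)) x \<rho>"
    if \<rho>: "0 < \<rho>" "\<rho> < R" "\<rho> < S" and int: "set_integrable M (ball x \<rho>) (\<lambda>x. max (f x) (h x))" for \<rho>
  proof -
    have "ball_mean M f x \<rho> \<le> ball_mean M (\<lambda>x. max (f x) (h x)) x \<rho>"
      using R(3)[of \<rho>] \<rho> int by (intro ball_mean_mono) auto
    moreover have "ball_mean M h x \<rho> \<le> ball_mean M (\<lambda>x. max (f x) (h x)) x \<rho>"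
      using S(3)[of \<rho>] \<rho> int by (intro ball_mean_mono) auto
    ultimately show ?thesis using R(3)[of \<rho>] S(3)[of \<rho>] \<rho> by fastforce
  qed
  then show "\<exists>R>0. closure (ball x R) \<subseteq> \<Omega> \<and> (\<forall>\<rho>. 0 < \<rho> \<and> \<rho> < R \<longrightarrow>
           set_integrable M (ball x \<rho>) (\<lambda>x. max (f x) (h x)) \<longrightarrow>
           max (f x) (h x) \<le> ball_mean M (\<lambda>x. max (f x) (h x)) x \<rho>)"
    using R S closure_ball_min[OF R(2)] by (intro exI[of _ "min R S"]) auto
qed

text \<open>The identity at the centre turns the integral of \<open>F n\<close> into
  \<open>F n x\<close> times the measure of the ball. Convergence at the centre thus gives
  convergence of the integrals to a finite limit, and monotone convergence yields integrability of
  \<open>v\<close> as well as its mean.\<close>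

lemma mean_value_on_monotone_limit:
  assumes F: "\<And>n. mean_value_on M B (F n)"
    and mono: "\<And>x. x \<in> B \<Longrightarrow> incseq (\<lambda>n. F n x)"
    and lim: "\<And>x. x \<in> B \<Longrightarrow> (\<lambda>n. F n x) \<longlonglongrightarrow> v x"
  shows "mean_value_on M B v"
  unfolding mean_value_on_def
proof (intro allI impI)
  fix x s assume xs: "0 < s \<and> cball x s \<subseteq> B"
  then have x: "x \<in> B" by auto
  have sub: "ball x s \<subseteq> B" using xs ball_subset_cball by blast
  have int: "integrable M (\<lambda>z. indicator (ball x s) z *\<^sub>R F n z)" for n
    using F xs unfolding mean_value_on_def set_integrable_def by blast
  have lim': "(\<lambda>n. indicator (ball x s) z *\<^sub>R F n z) \<longlonglongrightarrow> indicator (ball x s) z *\<^sub>R v z" for z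
    using lim[of z] sub by (cases "z \<in> ball x s") (auto simp: subset_iff)
  have "v x * measure M (ball x s) = (LINT z:ball x s|M. v z)"
    and vint: "set_integrable M (ball x s) v"
  proof -
    have mono': "AE z in M. mono (\<lambda>n. indicat_real (ball x s) z *\<^sub>R F n z)"
      using mono sub by (intro AE_I2) (auto simp: mono_def subset_iff split: split_indicator)
    have eq: "(LINT z|M. indicat_real (ball x s) z *\<^sub>R F n z) = F n x * measure M (ball x s)" for n
    proof -
      have "F n x = ball_mean M (F n) x s"
        using F xs unfolding mean_value_on_def by blast
      then show ?thesis
        using measure_ball_pos[of s x] xs
        by (simp add: ball_mean_def set_lebesgue_integral_def field_simps)
    qed
    have ilim: "(\<lambda>n. LINT z|M. indicat_real (ball x s) z *\<^sub>R F n z) \<longlonglongrightarrow> v x * measure M (ball x s)"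
      unfolding eq using lim[OF x] by (intro tendsto_intros)
    have meas: "(\<lambda>z. indicat_real (ball x s) z *\<^sub>R v z) \<in> borel_measurable M"
      using int by (intro borel_measurable_LIMSEQ_real[OF lim']) auto
    note mct = int mono' AE_I2[OF lim'] ilim meas
    show "v x * measure M (ball x s) = (LINT z:ball x s|M. v z)"
      unfolding set_lebesgue_integral_def using integral_monotone_convergence[OF mct] by simp
    show "set_integrable M (ball x s) v"
      unfolding set_integrable_def using integrable_monotone_convergence[OF mct] by simp
  qed
  then show "set_integrable M (ball x s) v \<and> v x = ball_mean M v x s"
    using measure_ball_pos[of s x] xs by (simp add: ball_mean_def field_simps)
qed

end

section \<open>Connectedness and the maximum principle\<close>

locale connected_balls_measure_space = proper_measure_space M
  for M :: "'a::metric_space measure" +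
  assumes connected_ball: "0 < r \<Longrightarrow> connected (ball (x::'a) r)"
begin

text \<open>All balls around one point share that point and exhaust the space. The maximum principle
  below compares a level set with the whole space and rests on this.\<close>

lemma connected_space: "connected (UNIV :: 'a set)"
proof -
  obtain a :: 'a where True by blast
  have "connected (\<Union>r\<in>{0<..}. ball a r)"
  proof (rule connected_Union)
    have "a \<in> \<Inter> (ball a ` {0<..})" by simp
    then show "\<Inter> (ball a ` {0<..}) \<noteq> {}" by blast
  qed (use connected_ball in auto)
  also have "(\<Union>r\<in>{0<..}. ball a r) = UNIV"
  proof -
    have "x \<in> ball a (dist a x + 1)" for x by simp
    moreover have "dist a x + 1 \<in> {0<..}" for x
      by (simp add: add_nonneg_pos)
    ultimately show ?thesis by blast
  qed
  finally show ?thesis .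
qed

lemma clopen_eq_empty_or_UNIV: "open (K :: 'a set) \<Longrightarrow> closed K \<Longrightarrow> K = {} \<or> K = UNIV"
  using connected_space by (auto simp: connected_clopen)

text \<open>If the maximum exceeded the boundary values, the set where it is attained would be a
  proper nonempty clopen subset of the space.\<close>

lemma maximum_principle:
  assumes U: "open U" "bounded U" "U \<noteq> UNIV" and cont: "continuous_on (closure U) f"
    and sub: "locally_subharmonic_on M U f"
    and le: "\<And>x. x \<in> frontier U \<Longrightarrow> f x \<le> c"
    and x: "x \<in> closure U"
  shows "f x \<le> c"
proof (rule ccontr)
  assume "\<not> f x \<le> c"
  have comp: "compact (closure U)" by (rule compact_closure_bounded) fact
  then obtain z where z: "z \<in> closure U" "\<And>y. y \<in> closure U \<Longrightarrow> f y \<le> f z"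
    using continuous_attains_sup[OF comp _ cont] x by (metis empty_iff)
  then have gt: "f z > c" using \<open>\<not> f x \<le> c\<close> z(2)[OF x] by linarith
  define K where "K = {y \<in> closure U. f y = f z}"
  \<comment> \<open>The frontier is excluded because its values are at most \<open>c\<close>, below
    the maximum.\<close>
  have KU: "K \<subseteq> U"
    using gt le U by (force simp: K_def frontier_def interior_open)
  have "closed K"
    unfolding K_def using continuous_closed_preimage_constant[OF cont closed_closure] by simp
  moreover have "open K"
    unfolding open_contains_ball
  proof
    fix y assume y: "y \<in> K"
    obtain R where R: "R > 0" "closure (ball y R) \<subseteq> U"
      "\<And>\<rho>. 0 < \<rho> \<Longrightarrow> \<rho> < R \<Longrightarrow> f y \<le> ball_mean M f y \<rho> \<and> set_integrable M (ball y \<rho>) f"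
      using locally_subharmonic_onD[OF sub, of y] y KU by blast
    have B: "ball y (R / 2) \<subseteq> U"
    proof -
      have "ball y (R / 2) \<subseteq> ball y R" using R by (intro subset_ball) simp
      then show ?thesis using R(2) closure_subset by blast
    qed
    then have Bc: "ball y (R / 2) \<subseteq> closure U" using closure_subset by blast
    \<comment> \<open>The mean inequality is granted only for radii strictly below \<open>R\<close>,
      hence \<open>R / 2\<close>.\<close>
    have "f w = f z" if "w \<in> ball y (R / 2)" for w
    proof (rule ball_mean_attains_max[of "R / 2" y])
      show "continuous_on (ball y (R / 2)) f"
        using cont B closure_subset by (meson continuous_on_subset subset_trans)
      show "f z \<le> ball_mean M f y (R / 2)" "set_integrable M (ball y (R / 2)) f"
        using R(3)[of "R / 2"] R(1) y by (auto simp: K_def)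
      show "f p \<le> f z" if "p \<in> ball y (R / 2)" for p using z(2) Bc that by blast
    qed (use R that in auto)
    then show "\<exists>e>0. ball y e \<subseteq> K"
      using R Bc by (intro exI[of _ "R / 2"]) (auto simp: K_def simp del: mem_ball)
  qed
  ultimately have "K = UNIV"
    using clopen_eq_empty_or_UNIV[of K] z by (auto simp: K_def)
  then show False using KU U by auto
qed

end

section \<open>The Perron family and its upper bound\<close>

locale perron_domain = connected_balls_measure_space M
  for M :: "'a::metric_space measure" +
  fixes \<Omega> :: "'a set" and g :: "'a \<Rightarrow> real"
  assumes mc: "metrically_continuous M"
    and open_\<Omega>: "open \<Omega>" and \<Omega>_ne: "\<Omega> \<noteq> {}" "\<Omega> \<noteq> UNIV" and compact_frontier: "compact (frontier \<Omega>)"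
    and g: "continuous_on (frontier \<Omega>) g"
    and dirichlet: "0 < r \<Longrightarrow> closure (ball x r) \<subseteq> \<Omega> \<Longrightarrow> continuous_on (frontier (ball x r)) h \<Longrightarrow>
           \<exists>u. dirichlet_solution M (ball x r) h u"
    and bounded_or_finite: "bounded \<Omega> \<or> (\<forall>x\<in>\<Omega>. lower_perron M \<Omega> g x < \<infinity>)"
begin

abbreviation "S \<equiv> perron_family M \<Omega> g"
abbreviation "P \<equiv> \<lambda>x. real_of_ereal (lower_perron M \<Omega> g x)"

lemma const_in_perron_family:
  "(\<And>x. x \<in> frontier \<Omega> \<Longrightarrow> c \<le> g x) \<Longrightarrow> (\<lambda>_. c) \<in> S"
  using locally_subharmonic_on_const[OF open_\<Omega>] by (auto simp: perron_family_def)

lemma g_bounded: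
  obtains c where "\<And>x. x \<in> frontier \<Omega> \<Longrightarrow> \<bar>g x\<bar> \<le> c"
  using compact_imp_bounded[OF compact_continuous_image[OF g compact_frontier]]
  unfolding bounded_iff by auto

text \<open>A subharmonic function with nonpositive boundary values that is positive somewhere could be
  scaled up inside the Perron family; so finiteness of the lower Perron solution yields the maximum
  principle on unbounded domains.\<close>

lemma maximum_principle_domain:
  assumes cont: "continuous_on (closure \<Omega>) u" and sub: "locally_subharmonic_on M \<Omega> u"
    and le: "\<And>x. x \<in> frontier \<Omega> \<Longrightarrow> u x \<le> 0" and y: "y \<in> \<Omega>"
  shows "u y \<le> 0"
proof (cases "bounded \<Omega>")
  case True
  then show ?thesis
    using maximum_principle[OF open_\<Omega> _ \<Omega>_ne(2) cont sub, of 0 y] le y closure_subset by auto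
next
  case False
  show ?thesis
  proof (rule ccontr)
    assume "\<not> u y \<le> 0"
    obtain c where c: "\<And>x. x \<in> frontier \<Omega> \<Longrightarrow> \<bar>g x\<bar> \<le> c" by (rule g_bounded) blast
    \<comment> \<open>Lowering by \<open>c\<close> fits every multiple under the data: on the
      boundary \<open>n * u\<close> is nonpositive and \<open>- c\<close> is below
      \<open>g\<close>.\<close>
    have fam: "(\<lambda>x. real n * u x + - c) \<in> S" for n
      unfolding perron_family_def
    proof (intro CollectI conjI ballI)
      show "locally_subharmonic_on M \<Omega> (\<lambda>x. real n * u x + - c)"
        by (intro locally_subharmonic_on_add locally_subharmonic_on_cmult sub
            locally_subharmonic_on_const open_\<Omega>) simp
      fix x assume "x \<in> frontier \<Omega>"
      then have "real n * u x \<le> 0" "\<bar>g x\<bar> \<le> c"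
        using le c by (auto intro: mult_nonneg_nonpos)
      then show "real n * u x + - c \<le> g x" by linarith
    qed (intro continuous_intros cont)
    have le_P: "ereal (real n * u y + - c) \<le> lower_perron M \<Omega> g y" for n
      unfolding lower_perron_def by (rule SUP_upper2[OF fam[of n]]) simp
    have "lower_perron M \<Omega> g y < \<infinity>" using bounded_or_finite False y by blast
    then obtain b where b: "lower_perron M \<Omega> g y \<le> ereal b"
      by (cases "lower_perron M \<Omega> g y") auto
    obtain n where "b + c < real n * u y"
      using reals_Archimedean3[of "u y"] \<open>\<not> u y \<le> 0\<close> by (metis not_le)
    moreover have "real n * u y + - c \<le> b"
      using order_trans[OF le_P[of n] b] by simp
    ultimately show False by linarith
  qed
qed

text \<open>With \<open>c\<close> a bound for \<open>\<bar>g\<bar>\<close> on the compact boundary,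
  the constant \<open>- c\<close> is a member, and the maximum principle for \<open>f - c\<close>
  bounds all members by \<open>c\<close>.\<close>

lemma lower_perron_finite:
  assumes x: "x \<in> \<Omega>"
  shows "lower_perron M \<Omega> g x = ereal (P x)"
proof -
  obtain c where c: "\<And>x. x \<in> frontier \<Omega> \<Longrightarrow> \<bar>g x\<bar> \<le> c" by (rule g_bounded) blast
  have "(\<lambda>_. - c) \<in> S" by (rule const_in_perron_family) (use c in force)
  then have "ereal (- c) \<le> lower_perron M \<Omega> g x"
    unfolding lower_perron_def by (rule SUP_upper2) simp
  then have lower: "lower_perron M \<Omega> g x \<noteq> - \<infinity>" by auto
  have "lower_perron M \<Omega> g x \<le> ereal c"
    unfolding lower_perron_def
  proof (rule SUP_least)
    fix f assume f: "f \<in> S"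
    have "f x + - c \<le> 0"
    proof (rule maximum_principle_domain[OF _ _ _ x])
      show "continuous_on (closure \<Omega>) (\<lambda>x. f x + - c)"
        using f by (intro continuous_intros) (auto simp: perron_family_def)
      show "locally_subharmonic_on M \<Omega> (\<lambda>x. f x + - c)"
        using f by (intro locally_subharmonic_on_add locally_subharmonic_on_const open_\<Omega>)
          (auto simp: perron_family_def)
      fix y assume "y \<in> frontier \<Omega>"
      then have "f y \<le> g y" "\<bar>g y\<bar> \<le> c" using f c by (auto simp: perron_family_def)
      then show "f y + - c \<le> 0" by linarith
    qed
    then show "ereal (f x) \<le> ereal c" by simp
  qed
  then show ?thesis using lower by (cases "lower_perron M \<Omega> g x") auto
qed

lemma le_P: "f \<in> S \<Longrightarrow> x \<in> \<Omega> \<Longrightarrow> f x \<le> P x"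
  using SUP_upper[of f S "\<lambda>f. ereal (f x)"] lower_perron_finite[of x]
  unfolding lower_perron_def by (metis ereal_less_eq(3))

lemma P_le:
  assumes "x \<in> \<Omega>" "\<And>f. f \<in> S \<Longrightarrow> f x \<le> c" shows "P x \<le> c"
proof -
  have "lower_perron M \<Omega> g x \<le> ereal c"
    unfolding lower_perron_def using assms by (intro SUP_least) simp
  then show ?thesis using lower_perron_finite[OF assms(1)] by (metis ereal_less_eq(3))
qed

lemma perron_family_max: "f \<in> S \<Longrightarrow> h \<in> S \<Longrightarrow> (\<lambda>x. max (f x) (h x)) \<in> S"
  by (auto simp: perron_family_def intro!: continuous_on_max locally_subharmonic_on_max)

section \<open>Poisson modification and increasing sequences\<close>

text \<open>The new function is the Dirichlet solution \<open>u\<close> with data \<open>f\<close>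
  inside the ball and \<open>f\<close> elsewhere. The maximum principle for \<open>f - u\<close>
  shows that the function only increases, and this increase is what preserves subharmonicity outside
  the ball.\<close>

lemma poisson_modification:
  assumes f: "f \<in> S" and r: "0 < r" and B: "closure (ball a r) \<subseteq> \<Omega>"
  shows "\<exists>F\<in>S. (\<forall>x\<in>closure \<Omega>. f x \<le> F x) \<and> mean_value_on M (ball a r) F"
proof -
  have fcont: "continuous_on (closure \<Omega>) f" and fsub: "locally_subharmonic_on M \<Omega> f"
    and fle: "\<And>x. x \<in> frontier \<Omega> \<Longrightarrow> f x \<le> g x"
    using f by (auto simp: perron_family_def)
  have sub: "ball a r \<subseteq> \<Omega>" using B closure_subset by blast
  have B': "closure (ball a r) \<subseteq> closure \<Omega>" using B closure_subset by blast
  have "continuous_on (frontier (ball a r)) f"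
    using fcont B' by (rule_tac continuous_on_subset) (auto simp: frontier_def)
  then obtain u where u: "dirichlet_solution M (ball a r) f u"
    using dirichlet[OF r B] by blast
  then have ucont: "continuous_on (closure (ball a r)) u" and umean: "mean_value_on M (ball a r) u"
    and ueq: "\<And>x. x \<in> frontier (ball a r) \<Longrightarrow> u x = f x"
    using strongly_harmonic_on_imp_mean_value_on by (auto simp: dirichlet_solution_def)
  have usub: "locally_subharmonic_on M (ball a r) u"
    using ucont umean closure_subset
    by (intro mean_value_locally_subharmonic_on) (auto intro: continuous_on_subset)
  \<comment> \<open>The mean value identity is invariant under a change of sign, so subtracting
    \<open>u\<close> keeps \<open>f\<close> subharmonic.\<close>
  have "locally_subharmonic_on M (ball a r) (\<lambda>x. - u x)"
    using ucont closure_subset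
    by (intro mean_value_locally_subharmonic_on mean_value_on_uminus umean continuous_on_minus)
      (auto intro: continuous_on_subset)
  then have diff: "locally_subharmonic_on M (ball a r) (\<lambda>x. f x + - u x)"
    using locally_subharmonic_on_subset[OF fsub open_ball sub]
    by (intro locally_subharmonic_on_add)
  have fu: "f x \<le> u x" if "x \<in> closure (ball a r)" for x
  proof -
    have "f x + - u x \<le> 0"
    proof (rule maximum_principle[OF open_ball bounded_ball _ _ diff _ that])
      show "ball a r \<noteq> UNIV" using sub \<Omega>_ne by auto
      show "continuous_on (closure (ball a r)) (\<lambda>x. f x + - u x)"
        using fcont ucont B' by (intro continuous_intros) (auto intro: continuous_on_subset)
    qed (use ueq in auto)
    then show ?thesis by simp
  qed
  define F where "F = (\<lambda>x. if x \<in> ball a r then u x else f x)"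
  have Fu: "F x = u x" if "x \<in> ball a r" for x using that by (simp add: F_def)
  have fF: "f x \<le> F x" for x
    using fu[of x] closure_subset[of "ball a r"] by (auto simp: F_def simp del: mem_ball)
  have Fcont: "continuous_on (closure \<Omega>) F"
  proof -
    \<comment> \<open>Gluing over two closed pieces, which overlap only in the frontier of the ball,
      where \<open>u\<close> and \<open>f\<close> agree.\<close>
    have "continuous_on (closure (ball a r) \<union> (closure \<Omega> - ball a r)) F"
      unfolding F_def
    proof (rule continuous_on_cases)
      show "continuous_on (closure \<Omega> - ball a r) f"
        using fcont by (rule continuous_on_subset) auto
      show "\<forall>x. x \<in> closure (ball a r) \<and> x \<notin> ball a r \<or> x \<in> closure \<Omega> - ball a r \<and> x \<in> ball a r
          \<longrightarrow> u x = f x"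
        using ueq by (auto simp: frontier_def interior_open simp del: mem_ball)
    qed (auto intro: ucont closed_Diff)
    moreover have "closure (ball a r) \<union> (closure \<Omega> - ball a r) = closure \<Omega>"
      using B' closure_subset by blast
    ultimately show ?thesis by simp
  qed
  have Fmean: "mean_value_on M (ball a r) F"
    by (rule mean_value_on_cong[OF umean]) (simp only: Fu)
  have Fsub: "locally_subharmonic_on M \<Omega> F"
  proof (rule locally_subharmonic_onI)
    show "continuous_on \<Omega> F" using Fcont closure_subset by (rule continuous_on_subset)
    fix x assume x: "x \<in> \<Omega>"
    show "\<exists>R>0. closure (ball x R) \<subseteq> \<Omega> \<and> (\<forall>\<rho>. 0 < \<rho> \<and> \<rho> < R \<longrightarrow>
        set_integrable M (ball x \<rho>) F \<longrightarrow> F x \<le> ball_mean M F x \<rho>)"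
    proof (cases "x \<in> ball a r")
      case True
      have "locally_subharmonic_on M (ball a r) F"
        using Fcont sub closure_subset Fmean
        by (intro mean_value_locally_subharmonic_on) (auto intro: continuous_on_subset)
      then show ?thesis
        using True sub unfolding locally_subharmonic_on_def by (meson subset_trans)
    next
      \<comment> \<open>This covers the frontier of the ball too: \<open>F\<close> equals
        \<open>f\<close> at \<open>x\<close> and is at least \<open>f\<close> everywhere, so the
        radius valid for \<open>f\<close> serves \<open>F\<close>.\<close>
      case False
      obtain R where R: "R > 0" "closure (ball x R) \<subseteq> \<Omega>"
        "\<And>\<rho>. 0 < \<rho> \<Longrightarrow> \<rho> < R \<Longrightarrow> f x \<le> ball_mean M f x \<rho> \<and> set_integrable M (ball x \<rho>) f"
        using locally_subharmonic_onD[OF fsub x] by blast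
      have "F x \<le> ball_mean M F x \<rho>"
        if \<rho>: "0 < \<rho>" "\<rho> < R" and int: "set_integrable M (ball x \<rho>) F" for \<rho>
      proof -
        have "F x = f x" using False by (simp add: F_def)
        also have "\<dots> \<le> ball_mean M f x \<rho>" using R \<rho> by blast
        also have "\<dots> \<le> ball_mean M F x \<rho>"
          using R \<rho> int fF by (intro ball_mean_mono) auto
        finally show ?thesis .
      qed
      then show ?thesis using R by blast
    qed
  qed
  have "F x \<le> g x" if "x \<in> frontier \<Omega>" for x
  proof -
    have "x \<notin> ball a r" using that sub open_\<Omega> by (auto simp: frontier_def interior_open)
    then show ?thesis using fle[OF that] by (simp add: F_def)
  qed
  then have "F \<in> S" using Fcont Fsub by (auto simp: perron_family_def)
  then show ?thesis using fF Fmean by blast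
qed

text \<open>Each step modifies the maximum of the next \<open>\<psi>\<close> and the preceding
  modification, so the sequence increases and stays above every given member. Its limit is harmonic
  on the ball and lies below \<open>P\<close>.\<close>

lemma perron_sequence_envelope:
  assumes \<psi>: "\<And>n. \<psi> n \<in> S" and r: "0 < r" and B: "closure (ball a r) \<subseteq> \<Omega>"
  shows "\<exists>F v. (\<forall>n. F n \<in> S) \<and>
    (\<forall>x\<in>ball a r. (\<forall>n. \<psi> n x \<le> F n x \<and> F n x \<le> v x) \<and> v x \<le> P x) \<and>
    (\<forall>x\<in>ball a r. (\<lambda>n. F n x) \<longlonglongrightarrow> v x) \<and> mean_value_on M (ball a r) v"
proof -
  have sub: "ball a r \<subseteq> \<Omega>" using B closure_subset by blast
  have "\<exists>F. \<forall>n. (F n \<in> S \<and> (\<forall>x\<in>closure \<Omega>. \<psi> n x \<le> F n x) \<and> mean_value_on M (ball a r) (F n))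
      \<and> (\<forall>x\<in>closure \<Omega>. F n x \<le> F (Suc n) x)"
  proof (rule dependent_nat_choice)
    show "\<exists>G. G \<in> S \<and> (\<forall>x\<in>closure \<Omega>. \<psi> 0 x \<le> G x) \<and> mean_value_on M (ball a r) G"
      using poisson_modification[OF \<psi> r B] by blast
    fix G n assume G: "G \<in> S \<and> (\<forall>x\<in>closure \<Omega>. \<psi> n x \<le> G x) \<and> mean_value_on M (ball a r) G"
    then have "(\<lambda>x. max (\<psi> (Suc n) x) (G x)) \<in> S" using \<psi> by (blast intro: perron_family_max)
    from poisson_modification[OF this r B]
    show "\<exists>H. (H \<in> S \<and> (\<forall>x\<in>closure \<Omega>. \<psi> (Suc n) x \<le> H x) \<and> mean_value_on M (ball a r) H)
        \<and> (\<forall>x\<in>closure \<Omega>. G x \<le> H x)"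
      by (meson max.boundedE)
  qed
  then obtain F where F: "\<And>n. F n \<in> S" "\<And>n x. x \<in> closure \<Omega> \<Longrightarrow> \<psi> n x \<le> F n x"
    "\<And>n. mean_value_on M (ball a r) (F n)" "\<And>n x. x \<in> closure \<Omega> \<Longrightarrow> F n x \<le> F (Suc n) x"
    by blast
  \<comment> \<open>This real supremum is meaningful on the ball, where \<open>P\<close> bounds the
    sequence.\<close>
  define v where "v = (\<lambda>x. SUP n. F n x)"
  have cl: "x \<in> closure \<Omega>" "x \<in> \<Omega>" if "x \<in> ball a r" for x
    using that sub closure_subset by blast+
  have inc: "incseq (\<lambda>n. F n x)" if "x \<in> ball a r" for x
    using F(4) cl[OF that] by (intro incseq_SucI) auto
  have bdd: "bdd_above (range (\<lambda>n. F n x))" if "x \<in> ball a r" for x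
    using le_P[OF F(1)] cl[OF that] by (intro bdd_aboveI[of _ "P x"]) auto
  have lim: "(\<lambda>n. F n x) \<longlonglongrightarrow> v x" if "x \<in> ball a r" for x
    unfolding v_def by (rule LIMSEQ_incseq_SUP[OF bdd inc]) (rule that)+
  have mean: "mean_value_on M (ball a r) v"
    by (rule mean_value_on_monotone_limit[OF F(3) inc lim])
  have "(\<forall>n. \<psi> n x \<le> F n x \<and> F n x \<le> v x) \<and> v x \<le> P x" if x: "x \<in> ball a r" for x
  proof (intro conjI allI)
    show "\<psi> n x \<le> F n x" for n using F(2) cl[OF x] by blast
    show "F n x \<le> v x" for n unfolding v_def by (rule cSUP_upper[OF _ bdd[OF x]]) simp
    show "v x \<le> P x"
      by (rule LIMSEQ_le_const2[OF lim[OF x]]) (use le_P[OF F(1)] cl[OF x] in auto)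
  qed
  then show ?thesis using F(1) lim mean by blast
qed

section \<open>Harmonicity of the lower Perron solution\<close>

lemma P_approximating_sequence:
  assumes x: "x \<in> \<Omega>"
  obtains \<phi> where "\<And>n. \<phi> n \<in> S" "\<And>n. P x - 1 / real (Suc n) < \<phi> n x"
proof -
  have "\<exists>f. f \<in> S \<and> P x - 1 / real (Suc n) < f x" for n
  proof (rule ccontr)
    assume "\<not> ?thesis"
    then have "P x \<le> P x - 1 / real (Suc n)" by (intro P_le[OF x]) (auto simp: not_less)
    then show False by simp
  qed
  then show ?thesis using that by metis
qed

lemma eq_P_if_approximated:
  assumes "\<And>n. P x - 1 / real (Suc n) < \<phi> n x" "\<And>n. \<phi> n x \<le> v" "v \<le> P x"
  shows "v = P x"
proof (rule antisym)
  have "(\<lambda>n. P x - 1 / real (Suc n)) \<longlonglongrightarrow> P x - 0"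
    by (intro tendsto_intros LIMSEQ_Suc[OF lim_1_over_n])
  moreover have "P x - 1 / real (Suc n) \<le> v" for n using assms(1,2)[of n] by linarith
  ultimately have "P x - 0 \<le> v" by (meson LIMSEQ_le_const2)
  then show "P x \<le> v" by simp
qed fact

text \<open>The strong minimum principle in a ball: the zero set is relatively closed by continuity
  and open because a mean of nonnegative values vanishes only if they do. Connectedness of the ball
  concludes.\<close>

lemma nonneg_mean_value_zero:
  assumes w: "mean_value_on M (ball a r) w" and nonneg: "\<And>x. x \<in> ball a r \<Longrightarrow> 0 \<le> w x"
    and z: "z \<in> ball a r" "w z = 0" and y: "y \<in> ball a r"
  shows "w y = 0"
proof -
  have cont: "continuous_on (ball a r) w" by (rule mean_value_continuous_on[OF mc open_ball w])
  have r: "0 < r" using z by (metis ball_empty empty_iff not_le)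
  have "openin (top_of_set (ball a r)) {x \<in> ball a r. w x = 0}"
  proof -
    have "open {x \<in> ball a r. w x = 0}"
      unfolding open_contains_ball
    proof
      fix x assume x: "x \<in> {x \<in> ball a r. w x = 0}"
      then have "x \<in> ball a r" by simp
      then obtain s where s: "0 < s" "cball x s \<subseteq> ball a r"
        using open_ball open_contains_cball by blast
      then have sb: "ball x s \<subseteq> ball a r" using ball_subset_cball by blast
      have ms: "set_integrable M (ball x s) w" "w x = ball_mean M w x s"
        using w s unfolding mean_value_on_def by auto
      \<comment> \<open>The sign change turns the minimum 0 of \<open>w\<close> into a maximum
        attained by the mean.\<close>
      have "- w q = 0" if "q \<in> ball x s" for q
      proof (rule ball_mean_attains_max[OF s(1) _ _ _ _ that])
        show "continuous_on (ball x s) (\<lambda>q. - w q)"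
          using cont sb by (intro continuous_on_minus) (auto intro: continuous_on_subset)
        show "set_integrable M (ball x s) (\<lambda>q. - w q)"
          using mean_value_on_uminus[OF w] s unfolding mean_value_on_def by auto
        have "ball_mean M (\<lambda>q. - w q) x s = - w x"
          using mean_value_on_uminus[OF w] s unfolding mean_value_on_def by auto
        then show "0 \<le> ball_mean M (\<lambda>q. - w q) x s" using x by simp
      qed (use nonneg sb in auto)
      then show "\<exists>e>0. ball x e \<subseteq> {x \<in> ball a r. w x = 0}"
        using s sb by (intro exI[of _ s]) auto
    qed
    then show ?thesis by (auto simp: openin_open_eq)
  qed
  then show ?thesis
    using continuous_levelset_openin[OF connected_ball[OF r] cont, of 0] z y by blast
qed

text \<open>The limit \<open>v\<close> is built from the centre alone, before any \<open>y\<close>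
  is chosen. Each \<open>y\<close> gets its own limit \<open>w\<close> above \<open>v\<close>, and
  \<open>w\<close> serves only to show \<open>v y = P y\<close>; the one function \<open>v\<close>
  thus represents \<open>P\<close> on the whole ball.\<close>

lemma P_mean_value_on_ball:
  assumes r: "0 < r" and B: "closure (ball a r) \<subseteq> \<Omega>"
  shows "mean_value_on M (ball a r) P"
proof -
  have sub: "ball a r \<subseteq> \<Omega>" using B closure_subset by blast
  have a: "a \<in> ball a r" using r by simp
  obtain \<phi> where \<phi>: "\<And>n. \<phi> n \<in> S" "\<And>n. P a - 1 / real (Suc n) < \<phi> n a"
    using P_approximating_sequence[of a] a sub by blast
  obtain F v where F: "\<And>n. F n \<in> S"
    and Fv: "\<And>n x. x \<in> ball a r \<Longrightarrow> \<phi> n x \<le> F n x \<and> F n x \<le> v x \<and> v x \<le> P x"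
    and lim: "\<And>x. x \<in> ball a r \<Longrightarrow> (\<lambda>n. F n x) \<longlonglongrightarrow> v x"
    and v: "mean_value_on M (ball a r) v"
    using perron_sequence_envelope[of \<phi>, OF \<phi>(1) r B] by blast
  have va: "v a = P a"
    by (rule eq_P_if_approximated[of a \<phi>, OF \<phi>(2)]) (use Fv[OF a] in \<open>auto intro: order_trans\<close>)
  have "v y = P y" if y: "y \<in> ball a r" for y
  proof -
    obtain \<theta> where \<theta>: "\<And>n. \<theta> n \<in> S" "\<And>n. P y - 1 / real (Suc n) < \<theta> n y"
      using P_approximating_sequence[of y] y sub by blast
    have max: "(\<lambda>x. max (F n x) (\<theta> n x)) \<in> S" for n
      using F \<theta>(1) by (rule perron_family_max)
    obtain G w where Gw: "\<And>n x. x \<in> ball a r \<Longrightarrow> max (F n x) (\<theta> n x) \<le> G n x \<and> G n x \<le> w x \<and> w x \<le> P x"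
      and w: "mean_value_on M (ball a r) w"
      using perron_sequence_envelope[of "\<lambda>n x. max (F n x) (\<theta> n x)", OF max r B] by blast
    have "w y = P y"
      by (rule eq_P_if_approximated[of y \<theta>, OF \<theta>(2)])
        (use Gw[OF y] in \<open>meson max.boundedE order_trans\<close>)+
    have vw: "v x \<le> w x" if "x \<in> ball a r" for x
      by (rule LIMSEQ_le_const2[OF lim[OF that]])
        (use Gw[OF that] in \<open>meson max.boundedE order_trans\<close>)
    have "w y - v y = 0"
    proof (rule nonneg_mean_value_zero[of a r "\<lambda>x. w x - v x" a y])
      \<comment> \<open>At the centre \<open>w\<close> is squeezed between \<open>v\<close> and
        \<open>P\<close>, which coincide there.\<close>
      show "w a - v a = 0" using vw[OF a] va Gw[OF a] by fastforce
    qed (use vw a y in \<open>auto intro: mean_value_on_diff v w\<close>)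
    then show ?thesis using \<open>w y = P y\<close> by simp
  qed
  then show ?thesis by (rule mean_value_on_cong[OF v])
qed

lemma P_continuous_on: "continuous_on \<Omega> P"
proof (rule continuous_at_imp_continuous_on, rule ballI)
  fix x assume "x \<in> \<Omega>"
  then obtain r where r: "r > 0" "cball x r \<subseteq> \<Omega>"
    using open_\<Omega> open_contains_cball by blast
  then have "closure (ball x r) \<subseteq> \<Omega>" using closure_ball_subset_cball by blast
  then have "continuous_on (ball x r) P"
    using r by (intro mean_value_continuous_on[OF mc] P_mean_value_on_ball) auto
  then show "isCont P x"
    using r by (simp add: continuous_on_eq_continuous_at)
qed

text \<open>On the ball itself the mean value identity is known only for smaller radii; the full radius
  is reached by exhaustion.\<close>

lemma P_strongly_harmonic: "strongly_harmonic_on M \<Omega> P"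
  unfolding strongly_harmonic_on_def locally_integrable_on_def compactly_contained_def
proof (intro conjI allI ballI impI)
  fix K assume "compact K \<and> K \<subseteq> \<Omega>"
  then show "set_integrable M K P"
    using P_continuous_on by (intro set_integrable_compact) (auto intro: continuous_on_subset)
next
  fix x r assume r: "0 < r" and B: "compact (closure (ball x r)) \<and> closure (ball x r) \<subseteq> \<Omega>"
  have mean: "mean_value_on M (ball x r) P" using P_mean_value_on_ball r B by blast
  \<comment> \<open>The shift by 2 makes already the first radius, \<open>r / 2\<close>,
    positive.\<close>
  define s where "s = (\<lambda>n. r - r / real (n + 2))"
  have s: "0 < s n" "s n < r" "s n \<le> s (Suc n)" for n
    using r by (auto simp: s_def field_simps intro: add_pos_nonneg)
  have slim: "s \<longlonglongrightarrow> r"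
  proof -
    have "(\<lambda>n. r - r * (1 / real (n + 2))) \<longlonglongrightarrow> r - r * 0"
      by (intro tendsto_intros LIMSEQ_ignore_initial_segment[OF lim_1_over_n])
    then show ?thesis by (simp add: s_def)
  qed
  have U: "(\<Union>n. ball x (s n)) = ball x r"
  proof (intro equalityI subsetI)
    fix z assume "z \<in> ball x r"
    then have "\<forall>\<^sub>F n in sequentially. dist x z < s n"
      by (intro order_tendstoD(1)[OF slim]) simp
    then show "z \<in> (\<Union>n. ball x (s n))" by (auto simp: eventually_sequentially)
  next
    fix z assume "z \<in> (\<Union>n. ball x (s n))"
    then show "z \<in> ball x r" using s(2) by (auto intro: less_trans)
  qed
  have inc: "incseq (\<lambda>n. ball x (s n))"
    using s(3) by (intro incseq_SucI subset_ball)
  \<comment> \<open>At the full radius integrability comes from continuity of \<open>P\<close> on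
    the compact closure.\<close>
  have "set_integrable M (ball x r) P"
    using set_integrable_ball[OF P_continuous_on, of x r r] B by blast
  then have 1: "(\<lambda>n. LINT z:ball x (s n)|M. P z) \<longlonglongrightarrow> (LINT z:ball x r|M. P z)"
    using set_integral_cont_up[of "\<lambda>n. ball x (s n)" M P] inc unfolding U by simp
  \<comment> \<open>Applied to the constant \<open>P x\<close>, the same exhaustion gives the limit
    of the measures; the two sequences of integrals agree term by term.\<close>
  have "(\<lambda>n. LINT z:ball x (s n)|M. P x) \<longlonglongrightarrow> (LINT z:ball x r|M. P x)"
    using set_integral_cont_up[of "\<lambda>n. ball x (s n)" M "\<lambda>_. P x"] inc set_integrable_ball_const
    unfolding U by simp
  moreover have "(LINT z:ball x (s n)|M. P x) = (LINT z:ball x (s n)|M. P z)" for n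
  proof -
    have "cball x (s n) \<subseteq> ball x r" using s(2)[of n] by (auto simp: subset_iff)
    then have "P x = ball_mean M P x (s n)"
      using mean s(1) unfolding mean_value_on_def by blast
    then show ?thesis
      using measure_ball_pos[OF s(1)[of n], of x]
      by (simp add: ball_mean_def ball_integral_const field_simps)
  qed
  ultimately have "(LINT z:ball x r|M. P x) = (LINT z:ball x r|M. P z)"
    using 1 LIMSEQ_unique by auto
  then show "P x = ball_mean M P x r"
    using measure_ball_pos[OF r, of x] by (simp add: ball_mean_def ball_integral_const field_simps)
qed

section \<open>Boundary values at a point with a barrier\<close>

text \<open>Near \<open>x0\<close> continuity of \<open>g\<close> provides \<open>e\<close>; on the
  compact rest of the boundary the barrier is bounded away from 0, so a large multiple dominates the
  oscillation of \<open>g\<close>. The bound is two-sided because it serves both the lower and the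
  upper estimate.\<close>

lemma boundary_data_barrier_bound:
  assumes f: "is_barrier M \<Omega> x0 f" and x0: "x0 \<in> frontier \<Omega>" and e: "0 < e"
  obtains k where "0 \<le> k" "\<And>x. x \<in> frontier \<Omega> \<Longrightarrow> \<bar>g x - g x0\<bar> \<le> e - k * f x"
proof -
  have fcont: "continuous_on (closure \<Omega>) f" and f0: "f x0 = 0"
    and fneg: "\<And>x. x \<in> frontier \<Omega> \<Longrightarrow> x \<noteq> x0 \<Longrightarrow> f x < 0"
    using f by (auto simp: is_barrier_def)
  obtain d where d: "d > 0" "\<And>x. x \<in> frontier \<Omega> \<Longrightarrow> dist x x0 < d \<Longrightarrow> dist (g x) (g x0) < e"
    using g x0 e unfolding continuous_on_iff by blast
  obtain c where c: "\<And>x. x \<in> frontier \<Omega> \<Longrightarrow> \<bar>g x\<bar> \<le> c" by (rule g_bounded) blast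
  define K where "K = frontier \<Omega> - ball x0 d"
  have K: "compact K" unfolding K_def by (intro compact_diff compact_frontier) auto
  obtain m where m: "m > 0" "\<And>x. x \<in> K \<Longrightarrow> f x \<le> - m"
  proof (cases "K = {}")
    case True
    then show ?thesis by (intro that[of 1]) auto
  next
    case False
    have "continuous_on K f"
      using fcont by (rule continuous_on_subset) (auto simp: K_def frontier_def)
    then obtain z where z: "z \<in> K" "\<And>x. x \<in> K \<Longrightarrow> f x \<le> f z"
      using continuous_attains_sup[OF K False] by blast
    have "f z < 0" using z(1) d(1) by (intro fneg) (auto simp: K_def)
    then show ?thesis using z by (intro that[of "- f z"]) auto
  qed
  have c0: "0 \<le> c" using c[OF x0] by linarith
  \<comment> \<open>Chosen so that \<open>k * m\<close> is \<open>2 * c\<close>, a bound for the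
    difference of two values of \<open>g\<close>.\<close>
  define k where "k = 2 * c / m"
  have k: "0 \<le> k" using c0 m by (simp add: k_def)
  show ?thesis
  proof (rule that[OF k])
    fix x assume x: "x \<in> frontier \<Omega>"
    have fx: "f x \<le> 0" using fneg[OF x] f0 by fastforce
    show "\<bar>g x - g x0\<bar> \<le> e - k * f x"
    proof (cases "x \<in> K")
      case True
      then have "k * m \<le> k * (- f x)" using m(2) k by (intro mult_left_mono) fastforce+
      then have "2 * c \<le> - (k * f x)" using m(1) by (simp add: k_def)
      then show ?thesis using c[OF x] c[OF x0] e by linarith
    next
      case False
      then have "\<bar>g x - g x0\<bar> < e"
        using d(2)[OF x] x by (simp add: K_def dist_commute dist_real_def)
      moreover have "k * f x \<le> 0" using k fx by (rule mult_nonneg_nonpos)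
      ultimately show ?thesis by linarith
    qed
  qed
qed

lemma P_tendsto_boundary:
  assumes f: "is_barrier M \<Omega> x0 f" and x0: "x0 \<in> frontier \<Omega>"
  shows "(P \<longlongrightarrow> g x0) (at x0 within \<Omega>)"
proof (rule tendstoI)
  fix e :: real assume e: "e > 0"
  have fcont: "continuous_on (closure \<Omega>) f" and fsub: "locally_subharmonic_on M \<Omega> f" and f0: "f x0 = 0"
    using f by (auto simp: is_barrier_def)
  obtain k where k: "0 \<le> k" "\<And>x. x \<in> frontier \<Omega> \<Longrightarrow> \<bar>g x - g x0\<bar> \<le> e / 2 - k * f x"
    using boundary_data_barrier_bound[OF f x0, of "e / 2"] e by auto
  have bound: "\<bar>P y - g x0\<bar> \<le> e / 2 - k * f y" if y: "y \<in> \<Omega>" for y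
  proof -
    have "(\<lambda>x. k * f x + (g x0 - e / 2)) \<in> S"
      unfolding perron_family_def
    proof (intro CollectI conjI ballI)
      show "locally_subharmonic_on M \<Omega> (\<lambda>x. k * f x + (g x0 - e / 2))"
        by (intro locally_subharmonic_on_add locally_subharmonic_on_cmult fsub
            locally_subharmonic_on_const open_\<Omega> k)
      show "k * f x + (g x0 - e / 2) \<le> g x" if "x \<in> frontier \<Omega>" for x
        using k(2)[OF that] by linarith
    qed (intro continuous_intros fcont)
    from le_P[OF this y] have lower: "k * f y + (g x0 - e / 2) \<le> P y" .
    have "P y \<le> g x0 + e / 2 - k * f y"
    proof (rule P_le[OF y])
      fix u assume u: "u \<in> S"
      \<comment> \<open>The majorant \<open>g x0 + e / 2 - k * f\<close> is not itself subharmonic,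
        but subtracting it from \<open>u\<close> adds a nonnegative multiple of \<open>f\<close>, so
        the maximum principle applies.\<close>
      have "u y + (k * f y + - (g x0 + e / 2)) \<le> 0"
      proof (rule maximum_principle_domain[OF _ _ _ y])
        show "continuous_on (closure \<Omega>) (\<lambda>x. u x + (k * f x + - (g x0 + e / 2)))"
          using u by (intro continuous_intros fcont) (auto simp: perron_family_def)
        show "locally_subharmonic_on M \<Omega> (\<lambda>x. u x + (k * f x + - (g x0 + e / 2)))"
          using u by (intro locally_subharmonic_on_add locally_subharmonic_on_cmult fsub
              locally_subharmonic_on_const open_\<Omega> k) (auto simp: perron_family_def)
        fix x assume x: "x \<in> frontier \<Omega>"
        then have "u x \<le> g x" using u by (auto simp: perron_family_def)
        then show "u x + (k * f x + - (g x0 + e / 2)) \<le> 0" using k(2)[OF x] by linarith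
      qed
      then show "u y \<le> g x0 + e / 2 - k * f y" by linarith
    qed
    then show ?thesis using lower by linarith
  qed
  have "(f \<longlongrightarrow> f x0) (at x0 within closure \<Omega>)"
    using fcont x0 unfolding continuous_on_def frontier_def by blast
  then have "(f \<longlongrightarrow> 0) (at x0 within \<Omega>)"
    using tendsto_within_subset[OF _ closure_subset] f0 by metis
  then have "((\<lambda>y. - (k * f y)) \<longlongrightarrow> - (k * 0)) (at x0 within \<Omega>)"
    by (intro tendsto_intros)
  \<comment> \<open>The multiple \<open>k\<close> depends on \<open>e\<close> but not on
    \<open>y\<close>, so the vanishing of the barrier at \<open>x0\<close> absorbs the last
    term.\<close>
  then have "\<forall>\<^sub>F y in at x0 within \<Omega>. - (k * f y) < e / 2"
    using e by (intro order_tendstoD(2)) auto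
  moreover have "\<forall>\<^sub>F y in at x0 within \<Omega>. y \<in> \<Omega>"
    by (simp add: eventually_at_filter)
  ultimately show "\<forall>\<^sub>F y in at x0 within \<Omega>. dist (P y) (g x0) < e"
  proof eventually_elim
    case (elim y)
    then show ?case using bound[of y] unfolding dist_real_def by linarith
  qed
qed

end

text \<open>Since \<open>real_of_ereal\<close> sends both infinities to 0, the first conjunct is
  what makes the other two speak of the Perron solution itself. The last assumption excludes domains
  like the half-line, where the supremum is infinite.\<close>

theorem theorem6p4:
  fixes M :: "'a::metric_space measure"
    and \<Omega> :: "'a set"
    and g :: "'a \<Rightarrow> real"
  assumes "borel_regular M"
    and "\<And>x r. r > 0 \<Longrightarrow> 0 < emeasure M (ball x r) \<and> emeasure M (ball x r) < \<infinity>"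
    and "\<And>(x::'a) r. compact (cball x r)"
    and "metrically_continuous M"
    and "\<And>(x::'a) r. r > 0 \<Longrightarrow> connected (ball x r)"
    and "is_domain \<Omega>" and "\<Omega> \<noteq> UNIV" and "compact (frontier \<Omega>)"
    and "continuous_on (frontier \<Omega>) g"
    and "\<And>x r h. r > 0 \<Longrightarrow> closure (ball x r) \<subseteq> \<Omega> \<Longrightarrow> continuous_on (frontier (ball x r)) h \<Longrightarrow>
           \<exists>u. dirichlet_solution M (ball x r) h u"
    and "bounded \<Omega> \<or> (\<forall>x\<in>\<Omega>. lower_perron M \<Omega> g x < \<infinity>)"
  shows "(\<forall>x\<in>\<Omega>. \<bar>lower_perron M \<Omega> g x\<bar> \<noteq> \<infinity>) \<and>
         strongly_harmonic_on M \<Omega> (\<lambda>x. real_of_ereal (lower_perron M \<Omega> g x)) \<and>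
         (\<forall>x0\<in>frontier \<Omega>. (\<exists>f. is_barrier M \<Omega> x0 f) \<longrightarrow>
            ((\<lambda>y. real_of_ereal (lower_perron M \<Omega> g y)) \<longlongrightarrow> g x0) (at x0 within \<Omega>))"
proof (cases "\<Omega> = {}")
  case True
  then show ?thesis
    by (auto simp: strongly_harmonic_on_def locally_integrable_on_def)
next
  case False
  interpret perron_domain M \<Omega> g
  proof
    show "sets borel \<subseteq> sets M" using assms(1) by (simp add: borel_regular_def)
    show "open \<Omega>" using assms(6) by (simp add: is_domain_def)
  qed (rule assms False | assumption)+
  have "\<bar>lower_perron M \<Omega> g x\<bar> \<noteq> \<infinity>" if "x \<in> \<Omega>" for x
    using lower_perron_finite[OF that] by (metis abs_ereal.simps(1) PInfty_neq_ereal(1))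
  then show ?thesis
    using P_strongly_harmonic P_tendsto_boundary by (intro conjI ballI impI) (blast | assumption)+
qed

end
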